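(* Let $G=(V,w,m)$ be a combinatorial graph and let $x_0\sim y_0$ be adjacent vertices. Let $B_{x_0y_0}:=B_1(x_0)\cap B_1(y_0)$, $B_{x_0}^{y_0}:=B_1(x_0)\setminus B_1(y_0)$ and $B_{y_0}^{x_0}:=B_1(y_0)\setminus B_1(x_0)$. Let $\Phi_{x_0y_0}$ be the set of all bijections $\phi:D(\phi)\to R(\phi)$ with $D(\phi)\subseteq B_{x_0}^{y_0}$ and $R(\phi)\subseteq B_{y_0}^{x_0}$ (the empty function is included). For $\phi\in\Phi_{x_0y_0}$ write $D(\phi)^c:=B_{x_0}^{y_0}\setminus D(\phi)$ and $R(\phi)^c:=B_{y_0}^{x_0}\setminus R(\phi)$. Then $$\kappa(x_0,y_0)=\#B_{x_0y_0}-\inf_{\phi\in\Phi_{x_0y_0}}\left(\#D(\phi)^c+\#R(\phi)^c+\sum_{x\in D(\phi)}[d(x,\phi(x))-1]\right).$$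
   Context: A graph is a triple $G=(V,w,m)$ with $V$ a countable set, $w:V\times V\to[0,\infty)$ symmetric and zero on the diagonal, and $m:V\to(0,\infty)$. Write $x\sim y$ if $w(x,y)>0$. All graphs are locally finite (for each $x$ only finitely many $y$ satisfy $x\sim y$) and connected; $d(x,y)=\inf\{n: x=x_0\sim\cdots\sim x_n=y\}$ is the combinatorial distance, which is finite by connectedness. $G$ is combinatorial if $w(x,y)\in\{0,1\}$ for all $x,y$ and $m\equiv1$. $B_1(x)=\{y: d(x,y)\le1\}$. $\mathrm{Deg}(x)=\frac1{m(x)}\sum_{y}w(x,y)$. $Lip(1)$ is the set of $f:V\to\mathbb R$ with $|f(x)-f(y)|\le d(x,y)$ for all $x,y$. Curvature: for $x\in V$ and $\varepsilon>0$ let $m_x^\varepsilon(x)=1-\varepsilon\,\mathrm{Deg}(x)$ and $m_x^\varepsilon(y)=\varepsilon w(x,y)/m(x)$ for $y\neq x$; this is a finitely supported probability measure for $\varepsilon$ small. For probability measures $\mu,\nu$ on $V$, $W(\mu,\nu)=\sup_{f}\sum_{x}f(x)(\mu(x)-\nu(x))$, the supremum over bounded $f\in Lip(1)$. For $x\neq y$ let $\kappa_\varepsilon(x,y)=1-\frac{W(m_x^\varepsilon,m_y^\varepsilon)}{d(x,y)}$ and $\kappa(x,y)=\lim_{\varepsilon\to0^+}\frac1\varepsilon\kappa_\varepsilon(x,y)$ (this limit exists). *)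

theory Defs
  imports "HOL-Analysis.Analysis"
begin

text \<open>The vertex set of a graph is the whole type \<open>'v\<close>, required to be countable
  (finite types included).\<close>

definition adjacent :: "('v \<Rightarrow> 'v \<Rightarrow> real) \<Rightarrow> 'v \<Rightarrow> 'v \<Rightarrow> bool" where
  "adjacent w x y \<longleftrightarrow> w x y > 0"

locale weighted_graph =
  fixes w :: "'v \<Rightarrow> 'v \<Rightarrow> real" and m :: "'v \<Rightarrow> real"
  assumes countable_vertices: "countable (UNIV :: 'v set)"
    and weight_nonneg: "w x y \<ge> 0"
    and weight_sym: "w x y = w y x"
    and weight_diag: "w x x = 0"
    and measure_pos: "m x > 0"
    and locally_finite: "finite {y. adjacent w x y}"
    and connected: "(adjacent w)\<^sup>*\<^sup>* x y"

definition combinatorial :: "('v \<Rightarrow> 'v \<Rightarrow> real) \<Rightarrow> ('v \<Rightarrow> real) \<Rightarrow> bool" where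
  "combinatorial w m \<longleftrightarrow> (\<forall>x y. w x y \<in> {0, 1}) \<and> (\<forall>x. m x = 1)"

text \<open>The power \<open>^^\<close> is relational: the infimum ranges over the lengths of paths from
  \<open>x\<close> to \<open>y\<close>, a nonempty set in a connected graph.\<close>

definition gdist :: "('v \<Rightarrow> 'v \<Rightarrow> real) \<Rightarrow> 'v \<Rightarrow> 'v \<Rightarrow> nat" where
  "gdist w x y = Inf {n. (adjacent w ^^ n) x y}"

definition ball1 :: "('v \<Rightarrow> 'v \<Rightarrow> real) \<Rightarrow> 'v \<Rightarrow> 'v set" where
  "ball1 w x = {y. gdist w x y \<le> 1}"

definition deg :: "('v \<Rightarrow> 'v \<Rightarrow> real) \<Rightarrow> ('v \<Rightarrow> real) \<Rightarrow> 'v \<Rightarrow> real" where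
  "deg w m x = 1 / m x * (\<Sum>\<^sub>\<infinity>y. w x y)"

definition lip1 :: "('v \<Rightarrow> 'v \<Rightarrow> real) \<Rightarrow> ('v \<Rightarrow> real) set" where
  "lip1 w = {f. \<forall>x y. \<bar>f x - f y\<bar> \<le> real (gdist w x y)}"

text \<open>Measures on the countable vertex set are given by their point masses.  The function
  \<open>jump_measure w m \<epsilon> x\<close> is a probability measure only for small \<open>\<epsilon>\<close>; larger values are
  irrelevant for the limit defining the curvature.\<close>

definition jump_measure ::
    "('v \<Rightarrow> 'v \<Rightarrow> real) \<Rightarrow> ('v \<Rightarrow> real) \<Rightarrow> real \<Rightarrow> 'v \<Rightarrow> 'v \<Rightarrow> real" where
  "jump_measure w m \<epsilon> x y = (if y = x then 1 - \<epsilon> * deg w m x else \<epsilon> * w x y / m x)"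

definition wasserstein :: "('v \<Rightarrow> 'v \<Rightarrow> real) \<Rightarrow> ('v \<Rightarrow> real) \<Rightarrow> ('v \<Rightarrow> real) \<Rightarrow> real" where
  "wasserstein w \<mu> \<nu> =
     (SUP f\<in>{f \<in> lip1 w. bounded (range f)}. \<Sum>\<^sub>\<infinity>x. f x * (\<mu> x - \<nu> x))"

definition curvature_eps ::
    "('v \<Rightarrow> 'v \<Rightarrow> real) \<Rightarrow> ('v \<Rightarrow> real) \<Rightarrow> real \<Rightarrow> 'v \<Rightarrow> 'v \<Rightarrow> real" where
  "curvature_eps w m \<epsilon> x y =
     1 - wasserstein w (jump_measure w m \<epsilon> x) (jump_measure w m \<epsilon> y) / real (gdist w x y)"

definition curvature ::
    "('v \<Rightarrow> 'v \<Rightarrow> real) \<Rightarrow> ('v \<Rightarrow> real) \<Rightarrow> 'v \<Rightarrow> 'v \<Rightarrow> real" where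
  "curvature w m x y = Lim (at_right 0) (\<lambda>\<epsilon>. 1 / \<epsilon> * curvature_eps w m \<epsilon> x y)"

text \<open>A bijection \<open>\<phi> : D(\<phi>) \<rightarrow> R(\<phi>)\<close> between subsets of \<open>A\<close> and \<open>B\<close> is encoded as a partial
  map with \<open>D(\<phi>) = dom \<phi>\<close> and \<open>R(\<phi>) = ran \<phi>\<close>.\<close>

definition partial_bijections :: "'v set \<Rightarrow> 'v set \<Rightarrow> ('v \<rightharpoonup> 'v) set" where
  "partial_bijections A B =
     {\<phi>. dom \<phi> \<subseteq> A \<and> ran \<phi> \<subseteq> B \<and> bij_betw (\<lambda>x. the (\<phi> x)) (dom \<phi>) (ran \<phi>)}"

end

theory Submission
  imports Defs
begin

text \<open>With \<open>A = B\<^sub>1(x\<^sub>0) - B\<^sub>1(y\<^sub>0)\<close>, \<open>B = B\<^sub>1(y\<^sub>0) - B\<^sub>1(x\<^sub>0)\<close> and \<open>C = B\<^sub>1(x\<^sub>0) \<inter> B\<^sub>1(y\<^sub>0)\<close>, the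
  transport functional of a 1-Lipschitz \<open>f\<close> is
  \<open>f x\<^sub>0 - f y\<^sub>0 + \<epsilon> (\<Sum>\<^sub>A (f - f x\<^sub>0) + \<Sum>\<^sub>B (f y\<^sub>0 - f) - #C (f x\<^sub>0 - f y\<^sub>0))\<close>. Pairing each \<open>a\<close> with
  \<open>\<phi> a\<close> bounds it by \<open>1 - \<epsilon> (#C - cost \<phi>)\<close> as soon as \<open>\<epsilon> (#C + #A) \<le> 1\<close>, since any deficit in
  \<open>f x\<^sub>0 - f y\<^sub>0 \<le> 1\<close> then loses more than it gains. Equality is a duality statement for the
  assignment problem in which an unmatched point costs 1: take integer dual variables
  \<open>u, v \<le> 1\<close> with \<open>u a + v b \<le> d(a,b) - 1\<close> of maximal total. Maximality is Hall's condition, along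
  tight pairs, for the points with \<open>u < 1\<close> and for those with \<open>v < 1\<close>; the two resulting
  matchings combine, as in the Banach--Schroeder--Bernstein theorem, into one \<open>\<phi>\<close> covering both.
  The dual variables extend to a 1-Lipschitz function by a McShane formula, so the Wasserstein
  distance is affine in \<open>\<epsilon>\<close> near 0.\<close>

section \<open>Duality for partial assignments\<close>

text \<open>Halmos-Vaughan induction. If some nonempty proper subset \<open>X\<close> has exactly
  \<open>card X\<close> neighbours, \<open>X\<close> and \<open>A - X\<close> are matched
  separately. Otherwise every such subset has a spare neighbour, so one element can be matched
  arbitrarily and removed.\<close>

lemma hall:
  fixes N :: "'a \<Rightarrow> 'b set"
  assumes "finite A"
    and "\<And>a. a \<in> A \<Longrightarrow> finite (N a)"
    and "\<And>X. X \<subseteq> A \<Longrightarrow> card X \<le> card (\<Union>(N ` X))"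
  shows "\<exists>f. inj_on f A \<and> (\<forall>a\<in>A. f a \<in> N a)"
  using assms
proof (induction A arbitrary: N rule: finite_psubset_induct)
  case (psubset A)
  have fin: "finite (\<Union>(N ` X))" if "X \<subseteq> A" for X
    using that psubset.hyps psubset.prems(1) by (meson finite_UN_I finite_subset subsetD)
  show ?case
  proof (cases "\<exists>X. X \<noteq> {} \<and> X \<subset> A \<and> card (\<Union>(N ` X)) = card X")
    case True
    then obtain X where X: "X \<noteq> {}" "X \<subset> A" "card (\<Union>(N ` X)) = card X" by blast
    define M where "M = \<Union>(N ` X)"
    have "\<exists>f. inj_on f X \<and> (\<forall>a\<in>X. f a \<in> N a)"
      by (rule psubset.IH) (use X psubset.prems in auto)
    then obtain f where f: "inj_on f X" "\<forall>a\<in>X. f a \<in> N a" by blast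
    have "\<exists>g. inj_on g (A - X) \<and> (\<forall>a\<in>A - X. g a \<in> N a - M)"
    proof (rule psubset.IH)
      show "A - X \<subset> A" using X by blast
      show "finite (N a - M)" if "a \<in> A - X" for a using that psubset.prems(1) by blast
      \<comment> \<open>Hall's condition survives the removal of \<open>M\<close>: apply it to the
        union of \<open>X\<close> and \<open>Y\<close>, then subtract the equality for
        \<open>X\<close>.\<close>
      fix Y assume Y: "Y \<subseteq> A - X"
      have eq: "\<Union>((\<lambda>a. N a - M) ` Y) = \<Union>(N ` (X \<union> Y)) - M" by (auto simp: M_def)
      have "card (\<Union>(N ` (X \<union> Y)) - M) = card (\<Union>(N ` (X \<union> Y))) - card M"
        by (rule card_Diff_subset) (use X fin[of X] in \<open>auto simp: M_def\<close>)
      moreover have "card (X \<union> Y) \<le> card (\<Union>(N ` (X \<union> Y)))"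
        by (rule psubset.prems(2)) (use X Y in auto)
      moreover have "card (X \<union> Y) = card X + card Y"
        by (rule card_Un_disjoint) (use X Y psubset.hyps in \<open>auto intro: finite_subset\<close>)
      ultimately show "card Y \<le> card (\<Union>((\<lambda>a. N a - M) ` Y))"
        using X(3) eq by (simp add: M_def)
    qed
    then obtain g where g: "inj_on g (A - X)" "\<forall>a\<in>A - X. g a \<in> N a - M" by blast
    define h where "h a = (if a \<in> X then f a else g a)" for a
    have "inj_on h (X \<union> (A - X))"
      unfolding inj_on_Un
    proof (intro conjI)
      show "inj_on h X" "inj_on h (A - X)" using f(1) g(1) by (auto simp: h_def inj_on_def)
      have "h ` (X - (A - X)) \<subseteq> M" using f(2) by (auto simp: h_def M_def)
      moreover have "h ` (A - X - X) \<inter> M = {}" using g(2) by (auto simp: h_def)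
      ultimately show "h ` (X - (A - X)) \<inter> h ` (A - X - X) = {}" by blast
    qed
    moreover have "X \<union> (A - X) = A" using X by blast
    moreover have "\<forall>a\<in>A. h a \<in> N a" using f g by (auto simp: h_def)
    ultimately show ?thesis by auto
  next
    case False
    show ?thesis
    proof (cases "A = {}")
      case nonempty: False
      then obtain a where a: "a \<in> A" by blast
      have "card {a} \<le> card (\<Union>(N ` {a}))" by (rule psubset.prems(2)) (use a in auto)
      then have "N a \<noteq> {}" by auto
      then obtain b where b: "b \<in> N a" by blast
      have "\<exists>g. inj_on g (A - {a}) \<and> (\<forall>x\<in>A - {a}. g x \<in> N x - {b})"
      proof (rule psubset.IH)
        show "A - {a} \<subset> A" using a by blast
        show "finite (N x - {b})" if "x \<in> A - {a}" for x using that psubset.prems(1) by blast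
        fix Y assume Y: "Y \<subseteq> A - {a}"
        have eq: "\<Union>((\<lambda>x. N x - {b}) ` Y) = \<Union>(N ` Y) - {b}" by auto
        show "card Y \<le> card (\<Union>((\<lambda>x. N x - {b}) ` Y))"
        proof (cases "Y = {}")
          case False
          \<comment> \<open>\<open>Y\<close> is a nonempty proper subset because it omits
            \<open>a\<close>, so it has a neighbour to spare, which pays for the loss of
            \<open>b\<close>.\<close>
          then have "card (\<Union>(N ` Y)) \<noteq> card Y"
            using \<open>\<not> (\<exists>X. _ X)\<close> Y a by blast
          moreover have "card Y \<le> card (\<Union>(N ` Y))"
            by (rule psubset.prems(2)) (use Y in auto)
          ultimately show ?thesis
            unfolding eq using card_Diff_singleton_if[of "\<Union>(N ` Y)" b] by (simp split: if_splits)
        qed simp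
      qed
      then obtain g where g: "inj_on g (A - {a})" "\<forall>x\<in>A - {a}. g x \<in> N x - {b}" by blast
      have "inj_on (g(a := b)) A" using g by (auto simp: inj_on_def)
      moreover have "\<forall>x\<in>A. (g(a := b)) x \<in> N x" using g b by auto
      ultimately show ?thesis by blast
    qed simp
  qed
qed

text \<open>If a set \<open>X\<close> of points with \<open>u < 1\<close> had fewer tight neighbours
  than elements, raising \<open>u\<close> by 1 on \<open>X\<close> and lowering \<open>v\<close> by
  1 on those neighbours would stay feasible and increase the total.\<close>

lemma tight_matching:
  fixes c :: "'a \<Rightarrow> 'b \<Rightarrow> int" and u :: "'a \<Rightarrow> int" and v :: "'b \<Rightarrow> int"
  assumes fin: "finite A" "finite B"
    and feas: "\<And>a. a \<in> A \<Longrightarrow> u a \<le> 1" "\<And>b. b \<in> B \<Longrightarrow> v b \<le> 1"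
      "\<And>a b. a \<in> A \<Longrightarrow> b \<in> B \<Longrightarrow> u a + v b \<le> c a b"
    and max: "\<And>u' v'. \<lbrakk>\<And>a. a \<in> A \<Longrightarrow> u' a \<le> 1; \<And>b. b \<in> B \<Longrightarrow> v' b \<le> 1;
      \<And>a b. a \<in> A \<Longrightarrow> b \<in> B \<Longrightarrow> u' a + v' b \<le> c a b\<rbrakk>
      \<Longrightarrow> (\<Sum>a\<in>A. u' a) + (\<Sum>b\<in>B. v' b) \<le> (\<Sum>a\<in>A. u a) + (\<Sum>b\<in>B. v b)"
  shows "\<exists>f. inj_on f {a\<in>A. u a < 1} \<and> (\<forall>a\<in>{a\<in>A. u a < 1}. f a \<in> {b\<in>B. u a + v b = c a b})"
proof (rule hall)
  fix X assume X: "X \<subseteq> {a\<in>A. u a < 1}"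
  define M where "M = (\<Union>a\<in>X. {b\<in>B. u a + v b = c a b})"
  have XA: "X \<subseteq> A" and MB: "M \<subseteq> B" using X by (auto simp: M_def)
  define u' where "u' a = u a + (if a \<in> X then 1 else 0)" for a
  define v' where "v' b = v b - (if b \<in> M then 1 else 0)" for b
  have "(\<Sum>a\<in>A. u' a) + (\<Sum>b\<in>B. v' b) \<le> (\<Sum>a\<in>A. u a) + (\<Sum>b\<in>B. v b)"
  proof (rule max)
    show "u' a \<le> 1" if "a \<in> A" for a using feas(1)[OF that] X by (auto simp: u'_def)
    show "v' b \<le> 1" if "b \<in> B" for b using feas(2)[OF that] by (auto simp: v'_def)
    \<comment> \<open>Only a pair with \<open>a\<close> in \<open>X\<close> and \<open>b\<close>
      outside \<open>M\<close> has its sum raised. It is not tight, so by integrality its slack is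
      at least 1.\<close>
    fix a b assume ab: "a \<in> A" "b \<in> B"
    show "u' a + v' b \<le> c a b"
      using feas(3)[OF ab] ab by (fastforce simp: u'_def v'_def M_def)
  qed
  moreover have "(\<Sum>a\<in>A. u' a) = (\<Sum>a\<in>A. u a) + int (card X)"
    using fin XA by (simp add: u'_def sum.distrib sum.If_cases Int_absorb1)
  moreover have "(\<Sum>b\<in>B. v' b) = (\<Sum>b\<in>B. v b) - int (card M)"
    using fin MB by (simp add: v'_def sum_subtractf sum.If_cases Int_absorb1)
  ultimately show "card X \<le> card (\<Union>a\<in>X. {b\<in>B. u a + v b = c a b})"
    unfolding M_def by linarith
qed (use fin in auto)

text \<open>Neither matching alone covers both \<open>A'\<close> and \<open>B'\<close>. As in the
  Schroeder-Bernstein argument, \<open>f\<close> is used on a set \<open>S\<close> and the inverse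
  of \<open>g\<close> elsewhere, with \<open>S\<close> chosen so that the two pieces fit
  together.\<close>

lemma combine_matchings:
  fixes f :: "'v \<Rightarrow> 'v"
  assumes f: "inj_on f A'" "f ` A' \<subseteq> B" "\<And>a. a \<in> A' \<Longrightarrow> P a (f a)"
    and g: "inj_on g B'" "g ` B' \<subseteq> A" "\<And>b. b \<in> B' \<Longrightarrow> P (g b) b"
    and sub: "A' \<subseteq> A" "B' \<subseteq> B"
  obtains \<phi> where "\<phi> \<in> partial_bijections A B" "A' \<subseteq> dom \<phi>" "B' \<subseteq> ran \<phi>"
    "\<And>a b. \<phi> a = Some b \<Longrightarrow> P a b"
proof -
  \<comment> \<open>At a fixed point, a point of \<open>A'\<close> outside \<open>S\<close> is hit
    by \<open>g\<close> from \<open>G\<close>, and a point of \<open>B'\<close> outside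
    \<open>G\<close> is hit by \<open>f\<close> from \<open>S\<close>. Two complements make
    \<open>F\<close> monotone, so a fixed point exists.\<close>
  define F where "F S = A' - g ` (B' - f ` S)" for S
  have "mono F" unfolding F_def by (intro monoI Diff_mono image_mono order_refl)
  define S where "S = lfp F"
  define G where "G = B' - f ` S"
  have S: "S = A' - g ` G"
    unfolding G_def using lfp_unfold[OF \<open>mono F\<close>] unfolding S_def F_def .
  have SG: "S \<inter> g ` G = {}" "A' \<subseteq> S \<union> g ` G" "S \<subseteq> A'"
    using S by blast+
  have SG': "G \<subseteq> B'" "f ` S \<inter> G = {}" "B' \<subseteq> f ` S \<union> G"
    by (auto simp: G_def)
  define h where "h a = (if a \<in> S then f a else the_inv_into G g a)" for a
  define \<phi> where "\<phi> a = (if a \<in> S \<union> g ` G then Some (h a) else None)" for a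
  have injg: "inj_on g G" using g(1) SG'(1) by (rule inj_on_subset)
  have injf: "inj_on f S" using f(1) SG(3) by (rule inj_on_subset)
  have hS: "h a = f a" if "a \<in> S" for a using that by (simp add: h_def)
  have hG: "h (g b) = b" if "b \<in> G" for b
    using that SG(1) the_inv_into_f_f[OF injg] by (auto simp: h_def)
  have dom: "dom \<phi> = S \<union> g ` G" by (auto simp: \<phi>_def dom_def)
  have ran: "ran \<phi> = h ` (S \<union> g ` G)" by (auto simp: \<phi>_def ran_def)
  also have "\<dots> = f ` S \<union> G" using hS hG by (auto simp: image_Un image_image)
  finally have ran': "ran \<phi> = f ` S \<union> G" .
  have "inj_on h (S \<union> g ` G)"
    unfolding inj_on_Un
  proof (intro conjI)
    show "inj_on h S" using injf hS by (simp cong: inj_on_cong)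
    show "inj_on h (g ` G)" using hG by (auto intro!: inj_onI)
    show "h ` (S - g ` G) \<inter> h ` (g ` G - S) = {}" using hS hG SG'(2) by fastforce
  qed
  then have "inj_on (\<lambda>x. the (\<phi> x)) (dom \<phi>)"
    unfolding dom by (rule inj_on_cong[THEN iffD1, rotated]) (simp add: \<phi>_def)
  moreover have "(\<lambda>x. the (\<phi> x)) ` dom \<phi> = ran \<phi>"
    unfolding dom ran by (rule image_cong) (auto simp: \<phi>_def)
  ultimately have bij: "bij_betw (\<lambda>x. the (\<phi> x)) (dom \<phi>) (ran \<phi>)" by (simp add: bij_betw_def)
  show ?thesis
  proof (rule that)
    show "\<phi> \<in> partial_bijections A B"
      unfolding partial_bijections_def
    proof (intro CollectI conjI bij)
      show "dom \<phi> \<subseteq> A" "ran \<phi> \<subseteq> B" unfolding dom ran' using SG(3) SG'(1) f(2) g(2) sub by blast+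
    qed
    show "A' \<subseteq> dom \<phi>" "B' \<subseteq> ran \<phi>" using SG SG' by (auto simp: dom ran')
    show "P a b" if "\<phi> a = Some b" for a b
      using that hS hG f(3) g(3) SG SG' by (auto simp: \<phi>_def split: if_splits)
  qed
qed

text \<open>The last three conclusions are complementary slackness: summed over all points, they
  make the dual total equal to the cost of \<open>\<phi>\<close>, where leaving a point unmatched
  costs 1.\<close>

lemma partial_assignment_duality:
  fixes c :: "'v \<Rightarrow> 'v \<Rightarrow> int"
  assumes fin: "finite A" "finite B"
    and c: "\<And>a b. a \<in> A \<Longrightarrow> b \<in> B \<Longrightarrow> 0 \<le> c a b"
  obtains u v :: "'v \<Rightarrow> int" and \<phi>
  where "\<And>a. a \<in> A \<Longrightarrow> u a \<le> 1" "\<And>b. b \<in> B \<Longrightarrow> v b \<le> 1"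
    "\<And>a b. a \<in> A \<Longrightarrow> b \<in> B \<Longrightarrow> u a + v b \<le> c a b"
    "\<phi> \<in> partial_bijections A B"
    "\<And>a. a \<in> A - dom \<phi> \<Longrightarrow> u a = 1" "\<And>b. b \<in> B - ran \<phi> \<Longrightarrow> v b = 1"
    "\<And>a b. \<phi> a = Some b \<Longrightarrow> u a + v b = c a b"
proof -
  define feas where "feas p \<longleftrightarrow> (\<forall>a\<in>A. fst p a \<le> 1) \<and> (\<forall>b\<in>B. snd p b \<le> 1) \<and>
    (\<forall>a\<in>A. \<forall>b\<in>B. fst p a + snd p b \<le> c a b)" for p :: "('v \<Rightarrow> int) \<times> ('v \<Rightarrow> int)"
  define tot where "tot p = (\<Sum>a\<in>A. fst p a) + (\<Sum>b\<in>B. snd p b)"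
    for p :: "('v \<Rightarrow> int) \<times> ('v \<Rightarrow> int)"
  have bound: "tot p \<le> int (card A) + int (card B)" if "feas p" for p
    unfolding tot_def
    using that sum_bounded_above[of A "fst p" 1] sum_bounded_above[of B "snd p" 1]
    by (auto simp: feas_def intro!: add_mono)
  have "feas (\<lambda>_. 0, \<lambda>_. 0)" using c by (auto simp: feas_def)
  \<comment> \<open>The totals are integers bounded above, so a maximum exists: minimise the gap to
    the bound as a natural number.\<close>
  then obtain p where p: "feas p" and
    least: "\<And>q. feas q \<Longrightarrow>
      nat (int (card A) + int (card B) - tot p) \<le> nat (int (card A) + int (card B) - tot q)"
    using ex_has_least_nat[of feas _ "\<lambda>p. nat (int (card A) + int (card B) - tot p)"] by blast
  have max: "tot q \<le> tot p" if "feas q" for q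
    using least[OF that] bound[OF that] bound[OF p] by linarith
  obtain u v where uv: "p = (u, v)" by (cases p)
  have feas': "\<And>a. a \<in> A \<Longrightarrow> u a \<le> 1" "\<And>b. b \<in> B \<Longrightarrow> v b \<le> 1"
    "\<And>a b. a \<in> A \<Longrightarrow> b \<in> B \<Longrightarrow> u a + v b \<le> c a b"
    using p by (auto simp: feas_def uv)
  have max': "(\<Sum>a\<in>A. u' a) + (\<Sum>b\<in>B. v' b) \<le> (\<Sum>a\<in>A. u a) + (\<Sum>b\<in>B. v b)"
    if "\<And>a. a \<in> A \<Longrightarrow> u' a \<le> 1" "\<And>b. b \<in> B \<Longrightarrow> v' b \<le> 1"
      "\<And>a b. a \<in> A \<Longrightarrow> b \<in> B \<Longrightarrow> u' a + v' b \<le> c a b" for u' v'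
    using max[of "(u', v')"] that by (simp add: feas_def tot_def uv)
  have "\<exists>f. inj_on f {a\<in>A. u a < 1} \<and> (\<forall>a\<in>{a\<in>A. u a < 1}. f a \<in> {b\<in>B. u a + v b = c a b})"
    by (rule tight_matching) (use fin feas' max' in auto)
  then obtain f where f: "inj_on f {a\<in>A. u a < 1}"
    "\<forall>a\<in>{a\<in>A. u a < 1}. f a \<in> {b\<in>B. u a + v b = c a b}" by blast
  \<comment> \<open>The same lemma with the two sides exchanged and the cost transposed.\<close>
  have "\<exists>g. inj_on g {b\<in>B. v b < 1} \<and> (\<forall>b\<in>{b\<in>B. v b < 1}. g b \<in> {a\<in>A. v b + u a = c a b})"
  proof (rule tight_matching[where c = "\<lambda>b a. c a b"])
    fix v' u' assume "\<And>b. b \<in> B \<Longrightarrow> v' b \<le> (1::int)" "\<And>a. a \<in> A \<Longrightarrow> u' a \<le> (1::int)"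
      "\<And>b a. b \<in> B \<Longrightarrow> a \<in> A \<Longrightarrow> v' b + u' a \<le> c a b"
    then show "(\<Sum>b\<in>B. v' b) + (\<Sum>a\<in>A. u' a) \<le> (\<Sum>b\<in>B. v b) + (\<Sum>a\<in>A. u a)"
      using max'[of u' v'] by (simp add: add.commute)
  qed (use fin feas' in \<open>auto simp: add.commute\<close>)
  then obtain g where g: "inj_on g {b\<in>B. v b < 1}"
    "\<forall>b\<in>{b\<in>B. v b < 1}. g b \<in> {a\<in>A. v b + u a = c a b}" by blast
  obtain \<phi> where \<phi>: "\<phi> \<in> partial_bijections A B" "{a\<in>A. u a < 1} \<subseteq> dom \<phi>"
    "{b\<in>B. v b < 1} \<subseteq> ran \<phi>" "\<And>a b. \<phi> a = Some b \<Longrightarrow> u a + v b = c a b"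
    by (rule combine_matchings[of f "{a\<in>A. u a < 1}" B "\<lambda>a b. u a + v b = c a b" g "{b\<in>B. v b < 1}" A])
      (use f g in \<open>auto simp: add.commute\<close>)
  show ?thesis
  proof (rule that)
    show "u a = 1" if "a \<in> A - dom \<phi>" for a using that \<phi>(2) feas'(1)[of a] by force
    show "v b = 1" if "b \<in> B - ran \<phi>" for b using that \<phi>(3) feas'(2)[of b] by force
  qed (use feas' \<phi> in auto)
qed

text \<open>Used with increments of a Lipschitz function for the upper bound and with dual variables
  for the optimal value.\<close>

lemma sum_partial_bijection:
  fixes p q :: "'v \<Rightarrow> real"
  assumes "finite A" "finite B" "\<phi> \<in> partial_bijections A B"
  shows "(\<Sum>a\<in>A. p a) + (\<Sum>b\<in>B. q b) =
    (\<Sum>a\<in>A - dom \<phi>. p a) + (\<Sum>b\<in>B - ran \<phi>. q b) + (\<Sum>a\<in>dom \<phi>. p a + q (the (\<phi> a)))"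
proof -
  have \<phi>: "dom \<phi> \<subseteq> A" "ran \<phi> \<subseteq> B" "bij_betw (\<lambda>x. the (\<phi> x)) (dom \<phi>) (ran \<phi>)"
    using assms by (auto simp: partial_bijections_def)
  have "(\<Sum>a\<in>A. p a) = (\<Sum>a\<in>A - dom \<phi>. p a) + (\<Sum>a\<in>dom \<phi>. p a)"
    "(\<Sum>b\<in>B. q b) = (\<Sum>b\<in>B - ran \<phi>. q b) + (\<Sum>b\<in>ran \<phi>. q b)"
    using \<phi> assms by (auto intro: sum.subset_diff)
  moreover have "(\<Sum>b\<in>ran \<phi>. q b) = (\<Sum>a\<in>dom \<phi>. q (the (\<phi> a)))"
    using sum.reindex_bij_betw[OF \<phi>(3), of q] by simp
  ultimately show ?thesis by (simp add: sum.distrib)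
qed

section \<open>Distance and transport in combinatorial graphs\<close>

context weighted_graph
begin

text \<open>Connectedness makes the set of path lengths nonempty, so its infimum in
  \<open>nat\<close> is attained rather than being a default value.\<close>

lemma gdist_path: "(adjacent w ^^ gdist w x y) x y"
proof -
  have "{n. (adjacent w ^^ n) x y} \<noteq> {}" using connected[of x y] by (auto simp: rtranclp_power)
  from Inf_nat_def1[OF this] show ?thesis by (simp add: gdist_def)
qed

lemma gdist_le: "(adjacent w ^^ n) x y \<Longrightarrow> gdist w x y \<le> n"
  unfolding gdist_def by (rule cInf_lower) auto

lemma gdist_eq_0_iff [simp]: "gdist w x y = 0 \<longleftrightarrow> x = y"
  using gdist_path[of x y] gdist_le[of 0 x y] by auto

lemma gdist_self [simp]: "gdist w x x = 0"
  by simp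

lemma gdist_triangle: "gdist w x z \<le> gdist w x y + gdist w y z"
  by (rule gdist_le) (auto simp: relpowp_add intro: gdist_path)

lemma gdist_sym: "gdist w x y = gdist w y x"
proof -
  have "(adjacent w ^^ n) y x" if "(adjacent w ^^ n) x y" for n x y
    using that
  proof (induction n arbitrary: y)
    case (Suc n)
    then obtain z where z: "(adjacent w ^^ n) x z" "adjacent w z y" by auto
    then have "adjacent w y z" using weight_sym[of y z] by (simp add: adjacent_def)
    then show ?case using Suc.IH[OF z(1)] by (rule relpowp_Suc_I2)
  qed simp
  then have "(adjacent w ^^ n) x y = (adjacent w ^^ n) y x" for n by blast
  then show ?thesis by (simp add: gdist_def)
qed

lemma gdist_le_1_iff: "gdist w x y \<le> 1 \<longleftrightarrow> x = y \<or> adjacent w x y"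
proof
  assume "gdist w x y \<le> 1"
  then consider "gdist w x y = 0" | "gdist w x y = 1" by linarith
  then show "x = y \<or> adjacent w x y"
    using gdist_path[of x y] by cases auto
next
  assume "x = y \<or> adjacent w x y"
  then show "gdist w x y \<le> 1" using gdist_le[of 1 x y] by auto
qed

lemma ball1_eq: "ball1 w x = insert x {y. adjacent w x y}"
  unfolding ball1_def using gdist_le_1_iff by auto

lemma finite_ball1: "finite (ball1 w x)"
  using locally_finite by (simp add: ball1_eq)

lemma not_adjacent_self: "\<not> adjacent w x x"
  by (simp add: adjacent_def weight_diag)

lemma combinatorial_weight:
  assumes "combinatorial w m"
  shows "w x y = (if adjacent w x y then 1 else 0)"
proof -
  have "w x y \<in> {0, 1}" using assms unfolding combinatorial_def by blast
  then show ?thesis by (auto simp: adjacent_def)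
qed

text \<open>The mean of \<open>f\<close> is its value at \<open>x\<close> plus
  \<open>\<epsilon>\<close> times its Laplacian; the term \<open>z = x\<close> of the right-hand sum
  vanishes. A general \<open>S\<close> lets both measures of an edge be summed over one finite
  set.\<close>

lemma jump_measure_sum:
  assumes comb: "combinatorial w m" and "finite S" "ball1 w x \<subseteq> S"
  shows "(\<Sum>z\<in>S. f z * jump_measure w m \<epsilon> x z) = f x + \<epsilon> * (\<Sum>z\<in>ball1 w x. f z - f x)"
proof -
  let ?N = "{y. adjacent w x y}"
  note w = combinatorial_weight[OF comb, of x]
  have m: "m x = 1" using comb by (simp add: combinatorial_def)
  have "(\<Sum>\<^sub>\<infinity>y. w x y) = (\<Sum>\<^sub>\<infinity>y\<in>?N. w x y)"
    by (rule infsum_cong_neutral) (auto simp: w)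
  also have "\<dots> = real (card ?N)" using locally_finite[of x] by (simp add: w)
  finally have deg: "deg w m x = card ?N" by (simp add: deg_def m)
  have "(\<Sum>z\<in>S. f z * jump_measure w m \<epsilon> x z) = (\<Sum>z\<in>ball1 w x. f z * jump_measure w m \<epsilon> x z)"
    by (rule sum.mono_neutral_right)
      (use assms in \<open>auto simp: ball1_eq jump_measure_def w m\<close>)
  also have "\<dots> = f x * (1 - \<epsilon> * card ?N) + (\<Sum>z\<in>?N. f z * jump_measure w m \<epsilon> x z)"
    using locally_finite[of x] not_adjacent_self[of x] by (simp add: ball1_eq jump_measure_def deg)
  also have "(\<Sum>z\<in>?N. f z * jump_measure w m \<epsilon> x z) = (\<Sum>z\<in>?N. \<epsilon> * f z)"
    by (rule sum.cong) (use not_adjacent_self[of x] in \<open>auto simp: jump_measure_def w m\<close>)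
  finally show ?thesis
    using locally_finite[of x] not_adjacent_self[of x]
    by (simp add: ball1_eq sum_subtractf sum_distrib_left algebra_simps)
qed

text \<open>On common points of the two balls the values \<open>f z\<close> cancel, and each such
  point leaves only \<open>- (f x - f y)\<close>.\<close>

lemma transport_functional:
  fixes f :: "'v \<Rightarrow> real"
  assumes comb: "combinatorial w m"
  shows "(\<Sum>\<^sub>\<infinity>z. f z * (jump_measure w m \<epsilon> x z - jump_measure w m \<epsilon> y z)) =
    f x - f y + \<epsilon> * ((\<Sum>z\<in>ball1 w x - ball1 w y. f z - f x) + (\<Sum>z\<in>ball1 w y - ball1 w x. f y - f z)
      - card (ball1 w x \<inter> ball1 w y) * (f x - f y))"
proof -
  let ?S = "ball1 w x \<union> ball1 w y"
  have fin: "finite ?S" by (simp add: finite_ball1)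
  have zero: "jump_measure w m \<epsilon> x' z = 0" if "z \<notin> ball1 w x'" for x' z
    using that combinatorial_weight[OF comb, of x' z] by (auto simp: jump_measure_def ball1_eq)
  have "(\<Sum>\<^sub>\<infinity>z. f z * (jump_measure w m \<epsilon> x z - jump_measure w m \<epsilon> y z)) =
    (\<Sum>\<^sub>\<infinity>z\<in>?S. f z * (jump_measure w m \<epsilon> x z - jump_measure w m \<epsilon> y z))"
    by (rule infsum_cong_neutral) (auto simp: zero)
  also have "\<dots> = (\<Sum>z\<in>?S. f z * jump_measure w m \<epsilon> x z) - (\<Sum>z\<in>?S. f z * jump_measure w m \<epsilon> y z)"
    using fin by (simp add: sum_subtractf algebra_simps)
  also have "\<dots> = (f x + \<epsilon> * (\<Sum>z\<in>ball1 w x. f z - f x)) - (f y + \<epsilon> * (\<Sum>z\<in>ball1 w y. f z - f y))"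
    using jump_measure_sum[OF comb fin] by simp
  also have "(\<Sum>z\<in>ball1 w x. f z - f x) =
      (\<Sum>z\<in>ball1 w x - ball1 w y. f z - f x) + (\<Sum>z\<in>ball1 w x \<inter> ball1 w y. f z - f x)"
    using sum.Int_Diff[OF finite_ball1] by (simp add: add.commute)
  also have "(\<Sum>z\<in>ball1 w y. f z - f y) =
      (\<Sum>z\<in>ball1 w y - ball1 w x. f z - f y) + (\<Sum>z\<in>ball1 w x \<inter> ball1 w y. f z - f y)"
    using sum.Int_Diff[OF finite_ball1] by (simp add: add.commute Int_commute)
  also have "(\<Sum>z\<in>ball1 w y - ball1 w x. f z - f y) = - (\<Sum>z\<in>ball1 w y - ball1 w x. f y - f z)"
    by (simp flip: sum_negf)
  finally show ?thesis by (simp add: sum_subtractf algebra_simps)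
qed

lemma lip1D: "f \<in> lip1 w \<Longrightarrow> f p - f q \<le> real (gdist w p q)"
  unfolding lip1_def by (blast intro: order_trans[OF abs_ge_self])

text \<open>Each function \<open>gdist w z t + g t\<close> of \<open>z\<close> is 1-Lipschitz by the
  triangle inequality, and finite minima and truncation preserve this.\<close>

lemma lip1_min_dist:
  assumes "finite T" "T \<noteq> {}"
  shows "(\<lambda>z. min r (MIN t\<in>T. real (gdist w z t) + g t)) \<in> lip1 w"
proof -
  have le: "min r (MIN t\<in>T. real (gdist w x t) + g t)
      \<le> min r (MIN t\<in>T. real (gdist w y t) + g t) + gdist w x y" for x y
  proof -
    have "(MIN t\<in>T. real (gdist w x t) + g t) - gdist w x y \<le> (MIN t\<in>T. real (gdist w y t) + g t)"
    proof (rule Min.boundedI)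
      fix s assume "s \<in> (\<lambda>t. real (gdist w y t) + g t) ` T"
      then obtain t where t: "t \<in> T" "s = real (gdist w y t) + g t" by blast
      have "(MIN t\<in>T. real (gdist w x t) + g t) \<le> real (gdist w x t) + g t"
        using t assms by (intro Min_le) auto
      moreover have "real (gdist w x t) \<le> real (gdist w x y) + real (gdist w y t)"
        using gdist_triangle[of x t y] by linarith
      ultimately show "(MIN t\<in>T. real (gdist w x t) + g t) - gdist w x y \<le> s" using t by linarith
    qed (use assms in auto)
    then show ?thesis by linarith
  qed
  show ?thesis
    unfolding lip1_def
  proof (intro CollectI allI)
    fix x y
    show "\<bar>min r (MIN t\<in>T. real (gdist w x t) + g t) - min r (MIN t\<in>T. real (gdist w y t) + g t)\<bar>
        \<le> real (gdist w x y)"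
      using le[of x y] le[of y x] gdist_sym[of x y] by linarith
  qed
qed

end

section \<open>Curvature of a single edge\<close>

definition matching_cost :: "('v \<Rightarrow> 'v \<Rightarrow> real) \<Rightarrow> 'v set \<Rightarrow> 'v set \<Rightarrow> ('v \<rightharpoonup> 'v) \<Rightarrow> real" where
  "matching_cost w A B \<phi> = real (card (A - dom \<phi>)) + real (card (B - ran \<phi>)) +
     (\<Sum>x\<in>dom \<phi>. real (gdist w x (the (\<phi> x))) - 1)"

locale graph_edge = weighted_graph +
  fixes x y
  assumes comb: "combinatorial w m" and edge: "adjacent w x y"
begin

definition A where "A = ball1 w x - ball1 w y"
definition B where "B = ball1 w y - ball1 w x"
definition C where "C = ball1 w x \<inter> ball1 w y"

lemma gdist_edge: "gdist w x y = 1"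
proof -
  have "x \<noteq> y" using edge not_adjacent_self by auto
  then show ?thesis using edge gdist_le_1_iff[of x y] gdist_eq_0_iff[of x y] by linarith
qed

lemma finite_AB: "finite A" "finite B"
  by (auto simp: A_def B_def finite_ball1)

lemma gdist_A: "a \<in> A \<Longrightarrow> gdist w a x = 1" "a \<in> A \<Longrightarrow> gdist w a y = 2"
proof -
  assume a: "a \<in> A"
  then have 1: "gdist w x a \<le> 1" "\<not> gdist w y a \<le> 1" by (auto simp: A_def ball1_def)
  have "gdist w a y \<le> gdist w a x + gdist w x y" by (rule gdist_triangle)
  then show "gdist w a x = 1" "gdist w a y = 2"
    using 1 gdist_edge gdist_sym[of a x] gdist_sym[of a y] by linarith+
qed

lemma gdist_B: "b \<in> B \<Longrightarrow> gdist w y b = 1" "b \<in> B \<Longrightarrow> gdist w x b = 2"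
proof -
  assume b: "b \<in> B"
  then have 1: "gdist w y b \<le> 1" "\<not> gdist w x b \<le> 1" by (auto simp: B_def ball1_def)
  have "gdist w x b \<le> gdist w x y + gdist w y b" by (rule gdist_triangle)
  then show "gdist w y b = 1" "gdist w x b = 2" using 1 gdist_edge by linarith+
qed

lemma functional_upper_bound:
  fixes \<epsilon> :: real
  assumes f: "f \<in> lip1 w" and \<phi>: "\<phi> \<in> partial_bijections A B"
    and \<epsilon>: "0 \<le> \<epsilon>" "\<epsilon> * (card C + card A) \<le> 1"
  shows "(\<Sum>\<^sub>\<infinity>z. f z * (jump_measure w m \<epsilon> x z - jump_measure w m \<epsilon> y z))
    \<le> 1 - \<epsilon> * (card C - matching_cost w A B \<phi>)"
proof -
  define t where "t = 1 - (f x - f y)"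
  have t: "0 \<le> t" using lip1D[OF f, of x y] gdist_edge by (simp add: t_def)
  have D: "dom \<phi> \<subseteq> A" using \<phi> by (auto simp: partial_bijections_def)
  have "(\<Sum>a\<in>A. f a - f x) + (\<Sum>b\<in>B. f y - f b) =
      (\<Sum>a\<in>A - dom \<phi>. f a - f x) + (\<Sum>b\<in>B - ran \<phi>. f y - f b) +
      (\<Sum>a\<in>dom \<phi>. f a - f x + (f y - f (the (\<phi> a))))"
    by (rule sum_partial_bijection[OF finite_AB \<phi>])
  \<comment> \<open>An unmatched point is at distance 1 from its centre and gains at most 1. A
    matched pair gains \<open>(f a - f b) - (f x - f y)\<close>, and
    \<open>f x - f y = 1 - t\<close>.\<close>
  also have "\<dots> \<le> (\<Sum>a\<in>A - dom \<phi>. 1) + (\<Sum>b\<in>B - ran \<phi>. 1) +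
      (\<Sum>a\<in>dom \<phi>. (real (gdist w a (the (\<phi> a))) - 1) + t)"
  proof (intro add_mono[OF add_mono] sum_mono)
    show "f a - f x \<le> 1" if "a \<in> A - dom \<phi>" for a
      using lip1D[OF f, of a x] gdist_A that by simp
    show "f y - f b \<le> 1" if "b \<in> B - ran \<phi>" for b
      using lip1D[OF f, of y b] gdist_B that by simp
    show "f a - f x + (f y - f (the (\<phi> a))) \<le> real (gdist w a (the (\<phi> a))) - 1 + t"
      if "a \<in> dom \<phi>" for a
      using lip1D[OF f, of a "the (\<phi> a)"] by (simp add: t_def)
  qed
  also have "\<dots> = matching_cost w A B \<phi> + card (dom \<phi>) * t"
    by (simp add: matching_cost_def sum.distrib)
  also have "\<dots> \<le> matching_cost w A B \<phi> + card A * t"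
    using card_mono[OF finite_AB(1) D] t by (simp add: mult_right_mono)
  finally have "\<epsilon> * ((\<Sum>a\<in>A. f a - f x) + (\<Sum>b\<in>B. f y - f b) - card C * (f x - f y))
      \<le> \<epsilon> * (matching_cost w A B \<phi> + card A * t - card C * (f x - f y))"
    using \<epsilon> by (intro mult_left_mono) auto
  also have "\<dots> = \<epsilon> * (card C + card A) * t - \<epsilon> * (card C - matching_cost w A B \<phi>)"
    by (simp add: t_def algebra_simps)
  \<comment> \<open>The smallness of \<open>\<epsilon>\<close> enters here: the gain proportional to
    the deficit \<open>t\<close> is at most \<open>t\<close> itself, which
    \<open>f x - f y = 1 - t\<close> has already lost.\<close>
  also have "\<dots> \<le> t - \<epsilon> * (card C - matching_cost w A B \<phi>)"
    using mult_right_mono[OF \<epsilon>(2) t] by simp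
  finally show ?thesis
    unfolding transport_functional[OF comb] A_def[symmetric] B_def[symmetric] C_def[symmetric]
    by (simp add: t_def)
qed

text \<open>The function aims at the values 0 at \<open>y\<close>, 1 at \<open>x\<close>,
  \<open>- v b\<close> on \<open>B\<close> and \<open>u a + 1\<close> on \<open>A\<close>; dual
  feasibility is the Lipschitz condition between \<open>A\<close> and \<open>B\<close>. Lower bounds
  on \<open>A\<close> and upper bounds on \<open>B\<close> are enough.\<close>

lemma optimal_pair:
  obtains f \<phi> where "f \<in> lip1 w" "bounded (range f)" "\<phi> \<in> partial_bijections A B"
    "f x - f y = 1" "matching_cost w A B \<phi> \<le> (\<Sum>a\<in>A. f a - f x) + (\<Sum>b\<in>B. f y - f b)"
proof -
  \<comment> \<open>\<open>A\<close> and \<open>B\<close> are disjoint, so the shifted cost is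
    nonnegative, as the duality lemma requires.\<close>
  have pos: "0 \<le> int (gdist w a b) - 1" if "a \<in> A" "b \<in> B" for a b
  proof -
    have "a \<noteq> b" using that by (auto simp: A_def B_def)
    then have "gdist w a b \<noteq> 0" by simp
    then show ?thesis by linarith
  qed
  obtain u v :: "_ \<Rightarrow> int" and \<phi> where u: "\<And>a. a \<in> A \<Longrightarrow> u a \<le> 1" and v: "\<And>b. b \<in> B \<Longrightarrow> v b \<le> 1"
    and uv: "\<And>a b. a \<in> A \<Longrightarrow> b \<in> B \<Longrightarrow> u a + v b \<le> int (gdist w a b) - 1"
    and \<phi>: "\<phi> \<in> partial_bijections A B"
    and u1: "\<And>a. a \<in> A - dom \<phi> \<Longrightarrow> u a = 1" and v1: "\<And>b. b \<in> B - ran \<phi> \<Longrightarrow> v b = 1"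
    and tight: "\<And>a b. \<phi> a = Some b \<Longrightarrow> u a + v b = int (gdist w a b) - 1"
    by (rule partial_assignment_duality[OF finite_AB, of "\<lambda>a b. int (gdist w a b) - 1"])
      (use pos in auto)
  define g where "g b = (if b = y then 0 else - real_of_int (v b))" for b
  \<comment> \<open>Including \<open>y\<close> anchors \<open>f y\<close> at 0 and keeps
    \<open>T\<close> nonempty even if \<open>B\<close> is empty.\<close>
  define T where "T = insert y B"
  define h where "h z = (MIN t\<in>T. real (gdist w z t) + g t)" for z
  \<comment> \<open>The cut-off at 2, the largest value needed on \<open>A\<close>, makes the McShane extension bounded.\<close>
  define f where "f z = min 2 (h z)" for z
  have T: "finite T" "T \<noteq> {}" using finite_AB by (auto simp: T_def)
  have yB: "y \<notin> B" using edge weight_sym by (auto simp: B_def ball1_eq adjacent_def)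
  have f: "f \<in> lip1 w"
    unfolding f_def h_def by (rule lip1_min_dist[OF T])
  have h_le: "h z \<le> real (gdist w z t) + g t" if "t \<in> T" for z t
    unfolding h_def using that T by (intro Min_le) auto
  have h_ge: "s \<le> h z" if "s \<le> real (gdist w z y)"
    "\<And>b. b \<in> B \<Longrightarrow> s \<le> real (gdist w z b) - real_of_int (v b)" for s z
    unfolding h_def
    by (rule Min.boundedI) (use T that yB in \<open>auto simp: T_def g_def\<close>)
  have fA: "real_of_int (u a) + 1 \<le> f a" if "a \<in> A" for a
  proof -
    have "real_of_int (u a) + 1 \<le> h a"
    proof (rule h_ge)
      show "real_of_int (u a) + 1 \<le> real (gdist w a y)" using u[OF that] gdist_A(2)[OF that] by simp
      show "real_of_int (u a) + 1 \<le> real (gdist w a b) - real_of_int (v b)" if "b \<in> B" for b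
        using uv[OF \<open>a \<in> A\<close> that] by linarith
    qed
    then show ?thesis using u[OF that] by (simp add: f_def)
  qed
  have fB: "f b \<le> - real_of_int (v b)" if "b \<in> B" for b
    using h_le[of b b] that yB by (auto simp: T_def g_def f_def split: if_splits)
  \<comment> \<open>The distance from \<open>x\<close> to \<open>B\<close> is 2 and \<open>v\<close>
    is at most 1, so no prescribed value on \<open>B\<close> forces \<open>h x\<close> below
    1.\<close>
  have "1 \<le> h x"
  proof (rule h_ge)
    show "1 \<le> real (gdist w x b) - real_of_int (v b)" if "b \<in> B" for b
      using gdist_B(2)[OF that] v[OF that] by simp
  qed (simp add: gdist_edge)
  then have fx: "1 \<le> f x" by (simp add: f_def)
  have fy: "f y \<le> 0" using h_le[of y y] by (simp add: T_def g_def f_def)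
  have fxy: "f x - f y \<le> 1" using lip1D[OF f, of x y] gdist_edge by simp
  have eq: "f x = 1" "f y = 0" using fx fy fxy by auto
  have "- 1 \<le> h z" for z
    by (rule h_ge) (use v in \<open>force+\<close>)
  then have "\<bar>f z\<bar> \<le> 2" for z using order_trans[of "-2" "-1" "h z"] by (simp add: f_def abs_le_iff min_def)
  then have bdd: "bounded (range f)" by (auto simp: bounded_iff)
  \<comment> \<open>Complementary slackness turns the cost of \<open>\<phi>\<close> into the dual
    total, term by term.\<close>
  have "matching_cost w A B \<phi> = (\<Sum>a\<in>A - dom \<phi>. real_of_int (u a)) + (\<Sum>b\<in>B - ran \<phi>. real_of_int (v b)) +
      (\<Sum>a\<in>dom \<phi>. real_of_int (u a) + real_of_int (v (the (\<phi> a))))"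
  proof -
    have "real (gdist w a (the (\<phi> a))) - 1 = real_of_int (u a) + real_of_int (v (the (\<phi> a)))"
      if "a \<in> dom \<phi>" for a
    proof -
      have "u a + v (the (\<phi> a)) = int (gdist w a (the (\<phi> a))) - 1" using that by (intro tight) auto
      then show ?thesis by linarith
    qed
    then show ?thesis using u1 v1 by (simp add: matching_cost_def)
  qed
  also have "\<dots> = (\<Sum>a\<in>A. real_of_int (u a)) + (\<Sum>b\<in>B. real_of_int (v b))"
    by (rule sum_partial_bijection[OF finite_AB \<phi>, symmetric])
  also have "\<dots> \<le> (\<Sum>a\<in>A. f a - f x) + (\<Sum>b\<in>B. f y - f b)"
    using fA fB eq by (intro add_mono sum_mono) (force simp: algebra_simps)+
  finally show ?thesis using f bdd \<phi> eq that[of f \<phi>] by simp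
qed

text \<open>For small \<open>\<epsilon>\<close> the pair \<open>f\<close>, \<open>\<phi>\<close>
  attains equality in the upper bound. This one fact identifies both the infimum over matchings and
  the Wasserstein distance.\<close>

lemma curvature_edge:
  "curvature w m x y = card C - (INF \<phi>\<in>partial_bijections A B. matching_cost w A B \<phi>)"
proof -
  obtain f \<phi> where f: "f \<in> lip1 w" "bounded (range f)" and \<phi>: "\<phi> \<in> partial_bijections A B"
    and fxy: "f x - f y = 1"
    and opt: "matching_cost w A B \<phi> \<le> (\<Sum>a\<in>A. f a - f x) + (\<Sum>b\<in>B. f y - f b)"
    by (rule optimal_pair)
  define I where "I g \<epsilon> = (\<Sum>\<^sub>\<infinity>z. g z * (jump_measure w m \<epsilon> x z - jump_measure w m \<epsilon> y z))" for g \<epsilon>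
  define K where "K = real (card C + card A)"
  \<comment> \<open>This makes \<open>K\<close> positive, so the range of \<open>\<epsilon>\<close>
    below \<open>1 / K\<close> is nonempty.\<close>
  have "x \<in> C" using edge weight_sym by (auto simp: C_def ball1_eq adjacent_def)
  moreover have "finite C" by (simp add: C_def finite_ball1)
  ultimately have K: "0 < K" using card_gt_0_iff[of C] by (auto simp: K_def)
  have upper: "I g \<epsilon> \<le> 1 - \<epsilon> * (card C - matching_cost w A B \<psi>)"
    if "g \<in> lip1 w" "\<psi> \<in> partial_bijections A B" "0 < \<epsilon>" "\<epsilon> < 1 / K" for g \<psi> \<epsilon>
    unfolding I_def
    by (rule functional_upper_bound) (use that K in \<open>auto simp: K_def field_simps\<close>)
  have lower: "1 - \<epsilon> * (card C - matching_cost w A B \<phi>) \<le> I f \<epsilon>" if "0 < \<epsilon>" for \<epsilon>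
    unfolding I_def transport_functional[OF comb] A_def[symmetric] B_def[symmetric] C_def[symmetric]
    using mult_left_mono[OF opt, of \<epsilon>] that fxy by (simp add: algebra_simps)
  have "(INF \<psi>\<in>partial_bijections A B. matching_cost w A B \<psi>) = matching_cost w A B \<phi>"
  proof (rule cInf_eq_minimum)
    show "matching_cost w A B \<phi> \<le> s" if s: "s \<in> matching_cost w A B ` partial_bijections A B" for s
    proof -
      obtain \<psi> where \<psi>: "\<psi> \<in> partial_bijections A B" "s = matching_cost w A B \<psi>" using s by blast
      \<comment> \<open>Any fixed value strictly between 0 and \<open>1 / K\<close> would serve: the
        bound from \<open>\<psi>\<close> applied to \<open>f\<close> is compared with the value that
        \<open>f\<close> reaches through \<open>\<phi>\<close>.\<close>
      define \<epsilon> where "\<epsilon> = 1 / (2 * K)"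
      have \<epsilon>: "0 < \<epsilon>" "\<epsilon> < 1 / K" using K by (auto simp: \<epsilon>_def field_simps)
      have "\<epsilon> * (card C - s) \<le> \<epsilon> * (card C - matching_cost w A B \<phi>)"
        using upper[OF f(1) \<psi>(1) \<epsilon>] lower[OF \<epsilon>(1)] unfolding \<psi>(2) by linarith
      then show ?thesis using \<epsilon>(1) by simp
    qed
  qed (use \<phi> in auto)
  moreover have "curvature w m x y = card C - matching_cost w A B \<phi>"
    unfolding curvature_def
  proof (rule tendsto_Lim)
    have "\<forall>\<^sub>F \<epsilon> in at_right 0. 0 < \<epsilon> \<and> \<epsilon> < 1 / K"
      using K by (intro eventually_at_rightI[of _ "1 / K"]) auto
    \<comment> \<open>The quotient is constant near 0, so its limit is immediate.\<close>
    then have "\<forall>\<^sub>F \<epsilon> in at_right 0. 1 / \<epsilon> * curvature_eps w m \<epsilon> x y = card C - matching_cost w A B \<phi>"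
    proof eventually_elim
      case (elim \<epsilon>)
      have "wasserstein w (jump_measure w m \<epsilon> x) (jump_measure w m \<epsilon> y)
          = 1 - \<epsilon> * (card C - matching_cost w A B \<phi>)"
        unfolding wasserstein_def I_def[symmetric]
      proof (rule cSup_eq_maximum)
        have "1 - \<epsilon> * (card C - matching_cost w A B \<phi>) = I f \<epsilon>"
          using upper[OF f(1) \<phi>] lower elim by (intro antisym) auto
        then show "1 - \<epsilon> * (card C - matching_cost w A B \<phi>)
            \<in> (\<lambda>f. I f \<epsilon>) ` {f \<in> lip1 w. bounded (range f)}"
          using f by auto
      qed (use upper \<phi> elim in auto)
      then show ?case using elim by (simp add: curvature_eps_def gdist_edge)
    qed
    then show "((\<lambda>\<epsilon>. 1 / \<epsilon> * curvature_eps w m \<epsilon> x y)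
        \<longlongrightarrow> card C - matching_cost w A B \<phi>) (at_right 0)"
      by (rule tendsto_eventually)
  qed simp
  ultimately show ?thesis by simp
qed

end

theorem theorem2p6:
  fixes w :: "'v \<Rightarrow> 'v \<Rightarrow> real" and m :: "'v \<Rightarrow> real" and x\<^sub>0 y\<^sub>0 :: 'v
  assumes "weighted_graph w m"
    and "combinatorial w m"
    and "adjacent w x\<^sub>0 y\<^sub>0"
  shows "curvature w m x\<^sub>0 y\<^sub>0 =
    real (card (ball1 w x\<^sub>0 \<inter> ball1 w y\<^sub>0)) -
    (INF \<phi>\<in>partial_bijections (ball1 w x\<^sub>0 - ball1 w y\<^sub>0) (ball1 w y\<^sub>0 - ball1 w x\<^sub>0).
       real (card ((ball1 w x\<^sub>0 - ball1 w y\<^sub>0) - dom \<phi>)) +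
       real (card ((ball1 w y\<^sub>0 - ball1 w x\<^sub>0) - ran \<phi>)) +
       (\<Sum>x\<in>dom \<phi>. real (gdist w x (the (\<phi> x))) - 1))"
proof -
  interpret weighted_graph w m by fact
  interpret graph_edge w m x\<^sub>0 y\<^sub>0 by unfold_locales fact+
  show ?thesis
    using curvature_edge unfolding matching_cost_def A_def B_def C_def .
qed

end
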